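(* Let $0\le\alpha<\pi/2$ and let $A\in\mathbb{M}_m(\mathbb{M}_n)$ satisfy $W(A)\subseteq S_\alpha$. Then \[ (\mathrm{tr}|A|)^{mn}+|\det(\mathrm{tr}_1 A)|^m\ge (m\cos\alpha)^{mn}\big(\det|A|+|\det(\mathrm{tr}_2 A)|^n\big), \] and \[ (\mathrm{tr}|A|)^{mn}+|\det(\mathrm{tr}_2 A)|^n\ge (n\cos\alpha)^{mn}\big(\det|A|+|\det(\mathrm{tr}_1 A)|^m\big). \]
   Context: $\mathbb{M}_m(\mathbb{M}_n)$ denotes the set of $mn\times mn$ complex matrices partitioned as $A=[A_{i,j}]_{i,j=1}^m$ with each block $A_{i,j}$ an $n\times n$ complex matrix. The partial traces are $\mathrm{tr}_1 A=\sum_{i=1}^m A_{i,i}\in\mathbb{M}_n$ and $\mathrm{tr}_2 A=[\mathrm{tr}\,A_{i,j}]_{i,j=1}^m\in\mathbb{M}_m$. Here $|A|=(A^*A)^{1/2}$ is the matrix modulus. The numerical range of $A\in\mathbb{M}_p$ is $W(A)=\{x^*Ax: x\in\mathbb{C}^p, x^*x=1\}$, and for $\alpha\in[0,\pi/2)$, $S_\alpha=\{z\in\mathbb{C}: \Re z>0,\ |\Im z|\le (\Re z)\tan\alpha\}$. *)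

theory Defs
  imports "HOL-Analysis.Analysis"
begin

text \<open>Block matrices in M_m(M_n) are represented as complex matrices indexed by
  the product type 'm \<times> 'n: the (i,j) block is the n\<times>n matrix
  (\<lambda>k l. A $ (i,k) $ (j,l)).\<close>

definition conj_transpose :: "complex^'n^'n \<Rightarrow> complex^'n^'n" where
  "conj_transpose A = (\<chi> i j. cnj (A $ j $ i))"

definition quad_form :: "complex^'n^'n \<Rightarrow> complex^'n \<Rightarrow> complex" where
  "quad_form A x = (\<Sum>i\<in>UNIV. \<Sum>j\<in>UNIV. cnj (x $ i) * A $ i $ j * x $ j)"

definition psd :: "complex^'n^'n \<Rightarrow> bool" where
  "psd B \<longleftrightarrow> conj_transpose B = B \<and>
     (\<forall>x. Im (quad_form B x) = 0 \<and> 0 \<le> Re (quad_form B x))"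

definition matrix_modulus :: "complex^'n^'n \<Rightarrow> complex^'n^'n" where
  "matrix_modulus A = (THE B. psd B \<and> B ** B = conj_transpose A ** A)"

definition numerical_range :: "complex^'n^'n \<Rightarrow> complex set" where
  "numerical_range A = {quad_form A x | x. (\<Sum>i\<in>UNIV. (cmod (x $ i))\<^sup>2) = 1}"

definition sector :: "real \<Rightarrow> complex set" where
  "sector \<alpha> = {z. 0 < Re z \<and> \<bar>Im z\<bar> \<le> Re z * tan \<alpha>}"

definition ptrace1 :: "complex^('m::finite \<times> 'n::finite)^('m \<times> 'n) \<Rightarrow> complex^'n^'n" where
  "ptrace1 A = (\<chi> k l. \<Sum>i\<in>UNIV. A $ (i,k) $ (i,l))"

definition ptrace2 :: "complex^('m::finite \<times> 'n::finite)^('m \<times> 'n) \<Rightarrow> complex^'m^'m" where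
  "ptrace2 A = (\<chi> i j. \<Sum>k\<in>UNIV. A $ (i,k) $ (j,k))"

end

theory Submission
  imports Defs
begin

text \<open>Write \<open>H = (A + A\<^sup>*) / 2\<close>, which is positive definite. Diagonalising the Hermitian and skew-Hermitian
  parts of a sectorial matrix \<open>B\<close> simultaneously by congruence gives
  \<open>det (Re B) \<le> |det B| \<le> (sec \<alpha>)\<^sup>p det (Re B)\<close> for \<open>p\<close> the size of \<open>B\<close>, and partial traces preserve
  sectoriality and commute with taking Hermitian parts. Both inequalities of the theorem then hold
  term by term: \<open>m\<^sup>m\<^sup>n det(tr\<^sub>2 H)\<^sup>n \<le> (tr H)\<^sup>m\<^sup>n \<le> (tr |A|)\<^sup>m\<^sup>n\<close> by the inequality of the means, and
  \<open>m\<^sup>m\<^sup>n det H \<le> det(tr\<^sub>1 H)\<^sup>m\<close>, which also follows from the inequality of the means after normalising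
  \<open>tr\<^sub>1 H\<close> to the identity.\<close>

section \<open>Spectral theorem for Hermitian matrices\<close>

text \<open>The quadratic form \<open>x \<bullet> f x\<close> attains its maximum on the compact
  unit sphere of \<open>V\<close>, and the first-order condition at a maximiser is the eigenvalue
  equation. Working inside an invariant subspace lets eigenvectors be collected one after
  another.\<close>

lemma self_adjoint_eigenvector_in_subspace:
  fixes f :: "'a::euclidean_space \<Rightarrow> 'a"
  assumes lin: "linear f" and sa: "\<And>x y. x \<bullet> f y = f x \<bullet> y"
    and V: "subspace V" "\<And>x. x \<in> V \<Longrightarrow> f x \<in> V" and v: "v \<in> V" "v \<noteq> 0"
  obtains x l where "x \<in> V" "norm x = 1" "f x = l *\<^sub>R x"
proof -
  let ?S = "sphere 0 1 \<inter> V"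
  have "compact ?S"
    by (simp add: closed_subspace V compact_Int_closed)
  moreover have "v /\<^sub>R norm v \<in> ?S"
    using v V by (auto simp: subspace_scale)
  moreover have "continuous_on ?S (\<lambda>x. x \<bullet> f x)"
    by (intro continuous_intros linear_continuous_on)
       (simp add: lin linear_conv_bounded_linear[symmetric])
  ultimately obtain x where x: "x \<in> ?S" and mx: "\<And>y. y \<in> ?S \<Longrightarrow> y \<bullet> f y \<le> x \<bullet> f x"
    using continuous_attains_sup[of ?S "\<lambda>x. x \<bullet> f x"] by blast
  define l where "l = x \<bullet> f x"
  have nx: "x \<bullet> x = 1" and xV: "x \<in> V"
    using x by (auto simp: dot_square_norm)
  have le: "y \<bullet> f y \<le> l * (y \<bullet> y)" if "y \<in> V" for y
  proof (cases "y = 0")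
    case True
    then show ?thesis by simp
  next
    case False
    then have "y /\<^sub>R norm y \<in> ?S"
      using that V by (auto simp: subspace_scale)
    from mx[OF this] have "(y \<bullet> f y) / (norm y * norm y) \<le> l"
      by (simp add: l_def linear_scale[OF lin] field_simps)
    then show ?thesis
      using False by (simp add: dot_square_norm power2_eq_square field_simps)
  qed
  define r where "r = f x - l *\<^sub>R x"
  have rV: "r \<in> V"
    unfolding r_def by (intro subspace_diff subspace_scale V xV)
  define C where "C = l * (r \<bullet> r) - r \<bullet> f r"
  \<comment> \<open>The form \<open>l * (y \<bullet> y) - y \<bullet> f y\<close> is nonnegative on
    \<open>V\<close> and vanishes at \<open>x\<close>. Along \<open>y = x + t *\<^sub>R r\<close> it
    equals \<open>t\<^sup>2 * C - 2 * t * (r \<bullet> r)\<close>.\<close>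
  have key: "2 * t * (r \<bullet> r) \<le> t\<^sup>2 * C" for t
  proof -
    have "x + t *\<^sub>R r \<in> V"
      by (intro subspace_add subspace_scale V xV rV)
    note le[OF this]
    also have "(x + t *\<^sub>R r) \<bullet> (x + t *\<^sub>R r) = 1 + 2 * t * (x \<bullet> r) + t\<^sup>2 * (r \<bullet> r)"
      using inner_commute[of r x]
      by (simp add: inner_add_left inner_add_right nx power2_eq_square distrib_left)
    also have "(x + t *\<^sub>R r) \<bullet> f (x + t *\<^sub>R r)
        = l + 2 * t * (r \<bullet> f x) + t\<^sup>2 * (r \<bullet> f r)"
      using sa[of x r] inner_commute[of "f x" r]
      by (simp add: linear_add[OF lin] linear_scale[OF lin] inner_add_left inner_add_right
          l_def power2_eq_square distrib_left)
    finally have "2 * t * (r \<bullet> f x - l * (x \<bullet> r)) \<le> t\<^sup>2 * C"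
      by (simp add: C_def right_diff_distrib distrib_left mult_ac)
    also have "r \<bullet> f x - l * (x \<bullet> r) = r \<bullet> r"
      by (subst (4) r_def) (simp only: inner_diff_right inner_scaleR_right inner_commute[of r x])
    finally show ?thesis .
  qed
  have "r \<bullet> r = 0"
  proof (rule ccontr)
    assume "r \<bullet> r \<noteq> 0"
    then have pos: "r \<bullet> r > 0"
      by (simp add: less_le)
    \<comment> \<open>A step so small that \<open>t * C\<close> is at most
      \<open>r \<bullet> r\<close>; the added 1 keeps the denominator positive when
      \<open>C = 0\<close>.\<close>
    define t where "t = (r \<bullet> r) / (\<bar>C\<bar> + 1)"
    have t: "t > 0"
      using pos by (simp add: t_def add_nonneg_pos)
    have "t * (2 * (r \<bullet> r)) \<le> t * (t * C)"
      using key[of t] by (simp add: power2_eq_square mult_ac)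
    with t have "2 * (r \<bullet> r) \<le> t * C"
      by simp
    also have "\<dots> \<le> t * (\<bar>C\<bar> + 1)"
      using t by (intro mult_left_mono) auto
    also have "\<dots> = r \<bullet> r"
      by (simp add: t_def add_nonneg_eq_0_iff)
    finally show False
      using pos by simp
  qed
  then have "f x = l *\<^sub>R x"
    by (simp add: r_def)
  with x that show ?thesis
    by auto
qed

section \<open>Complex inner product and orthonormal eigenvectors\<close>

definition cinner :: "complex^'n \<Rightarrow> complex^'n \<Rightarrow> complex" where
  "cinner x y = (\<Sum>i\<in>UNIV. cnj (x $ i) * y $ i)"

lemma Re_cinner: "Re (cinner x y) = x \<bullet> y"
  by (simp add: cinner_def inner_vec_def inner_complex_def)

text \<open>Together with \<open>Re_cinner\<close> this turns complex orthogonality to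
  \<open>x\<close> into real orthogonality to both \<open>x\<close> and \<open>\<i> *s x\<close>, so
  real Euclidean results apply.\<close>

lemma Im_cinner: "Im (cinner x y) = (\<i> *s x) \<bullet> y"
  by (simp add: cinner_def inner_vec_def inner_complex_def)

lemma cnj_cinner: "cnj (cinner x y) = cinner y x"
  by (simp add: cinner_def mult.commute)

lemma cinner_self: "cinner x x = of_real ((norm x)\<^sup>2)"
  by (rule complex_eqI) (simp_all add: Re_cinner dot_square_norm, simp add: cinner_def)

lemma cinner_add_right: "cinner x (y + z) = cinner x y + cinner x z"
  by (simp add: cinner_def algebra_simps sum.distrib)

lemma cinner_scale_right: "cinner x (c *s y) = c * cinner x y"
  by (simp add: cinner_def sum_distrib_left algebra_simps)

lemma cinner_scaleR_right: "cinner x (r *\<^sub>R y) = of_real r * cinner x y"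
  by (simp add: cinner_def sum_distrib_left) (simp add: scaleR_conv_of_real algebra_simps)

lemma cinner_scaleR_left: "cinner (r *\<^sub>R x) y = of_real r * cinner x y"
  by (simp add: cinner_def sum_distrib_left) (simp add: scaleR_conv_of_real algebra_simps)

lemma cinner_matrix_vector: "cinner x (A *v y) = cinner (conj_transpose A *v x) y"
proof -
  have "cinner x (A *v y) = (\<Sum>i\<in>UNIV. \<Sum>j\<in>UNIV. cnj (x $ i) * A $ i $ j * y $ j)"
    by (simp add: cinner_def matrix_vector_mult_def sum_distrib_left mult.assoc)
  also have "\<dots> = (\<Sum>j\<in>UNIV. \<Sum>i\<in>UNIV. cnj (x $ i) * A $ i $ j * y $ j)"
    by (rule sum.swap)
  also have "\<dots> = cinner (conj_transpose A *v x) y"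
    by (simp add: cinner_def matrix_vector_mult_def conj_transpose_def sum_distrib_right)
       (simp add: mult_ac)
  finally show ?thesis .
qed

lemma quad_form_cinner: "quad_form A x = cinner x (A *v x)"
  by (simp add: quad_form_def cinner_def matrix_vector_mult_def sum_distrib_left mult.assoc)

text \<open>Induction on the number of eigenvectors found: their orthogonal complement is invariant
  because \<open>A\<close> is Hermitian, and nonzero as long as \<open>k\<close> is below the
  dimension, so it contains a further eigenvector.\<close>

lemma hermitian_orthonormal_eigenvectors:
  fixes A :: "complex^'n^'n"
  assumes A: "conj_transpose A = A" and "k \<le> CARD('n)"
  shows "\<exists>S. finite S \<and> card S = k \<and> (\<forall>x\<in>S. \<exists>l::real. A *v x = l *\<^sub>R x) \<and>
     (\<forall>x\<in>S. \<forall>y\<in>S. cinner x y = (if x = y then 1 else 0))"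
  using assms(2)
proof (induction k)
  case 0
  then show ?case by (intro exI[of _ "{}"]) simp
next
  case (Suc k)
  then obtain S where S: "finite S" "card S = k" "\<And>x. x \<in> S \<Longrightarrow> \<exists>l::real. A *v x = l *\<^sub>R x"
     "\<And>x y. x \<in> S \<Longrightarrow> y \<in> S \<Longrightarrow> cinner x y = (if x = y then 1 else 0)"
    by (metis Suc_leD)
  define V where "V = {y. \<forall>x\<in>S. cinner x y = 0}"
  \<comment> \<open>The dimension count is over the reals: the \<open>k\<close> vectors and their
    multiples by \<open>\<i>\<close> span at most \<open>2k\<close> of the \<open>2n\<close> real
    dimensions.\<close>
  have "dim (S \<union> (*s) \<i> ` S) \<le> card (S \<union> (*s) \<i> ` S)"
    using S by (intro dim_le_card') auto
  also have "\<dots> \<le> k + k"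
    using S by (intro order_trans[OF card_Un_le] add_mono) (auto intro: card_image_le)
  also have "\<dots> < DIM(complex^'n)"
    using Suc.prems by simp
  finally obtain v where v: "v \<noteq> 0" "\<And>y. y \<in> span (S \<union> (*s) \<i> ` S) \<Longrightarrow> orthogonal v y"
    using orthogonal_to_subspace_exists by blast
  have vV: "v \<in> V"
    unfolding V_def
  proof (intro CollectI ballI)
    fix x assume "x \<in> S"
    then have "orthogonal v x" "orthogonal v (\<i> *s x)"
      by (auto intro!: v span_base)
    then show "cinner x v = 0"
      by (intro complex_eqI) (simp_all add: Re_cinner Im_cinner orthogonal_def inner_commute)
  qed
  have sub: "subspace V"
    unfolding V_def subspace_def
    by (auto simp: cinner_add_right cinner_scaleR_right, simp add: cinner_def)
  have inv: "A *v y \<in> V" if "y \<in> V" for y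
    unfolding V_def
  proof (intro CollectI ballI)
    fix x assume x: "x \<in> S"
    then obtain l :: real where "A *v x = l *\<^sub>R x"
      using S by blast
    then show "cinner x (A *v y) = 0"
      using that x by (simp add: cinner_matrix_vector A cinner_scaleR_left V_def)
  qed
  have sa: "x \<bullet> (A *v y) = (A *v x) \<bullet> y" for x y
    by (simp add: Re_cinner[symmetric] cinner_matrix_vector A)
  obtain x l where x: "x \<in> V" "norm x = 1" "A *v x = l *\<^sub>R x"
    using self_adjoint_eigenvector_in_subspace[of "(*v) A" V v] sa sub inv vV v(1)
    by (metis matrix_vector_mul_linear)
  have xx: "cinner x x = 1"
    using x by (simp add: cinner_self)
  have orth: "cinner y x = 0" "cinner x y = 0" if "y \<in> S" for y
    using x(1) that cnj_cinner[of y x] by (auto simp: V_def)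
  have "x \<notin> S"
    using orth xx by force
  then show ?case
    using S x orth xx by (intro exI[of _ "insert x S"]) auto
qed

section \<open>Diagonal matrices, conjugate transposition and unitary diagonalisation\<close>

definition diag_matrix :: "('n \<Rightarrow> complex) \<Rightarrow> complex^'n^'n" where
  "diag_matrix d = (\<chi> i j. if i = j then d i else 0)"

lemma diag_matrix_nth [simp]: "diag_matrix d $ i $ j = (if i = j then d i else 0)"
  by (simp add: diag_matrix_def)

lemma diag_matrix_mult_left_nth: "(diag_matrix d ** A) $ i $ j = d i * A $ i $ j"
proof -
  have "(diag_matrix d ** A) $ i $ j = (\<Sum>k\<in>UNIV. if k = i then d i * A $ i $ j else 0)"
    by (subst matrix_matrix_mult_def, simp only: vec_lambda_beta, intro sum.cong) auto
  then show ?thesis by simp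
qed

lemma diag_matrix_mult_right_nth: "(A ** diag_matrix d) $ i $ j = A $ i $ j * d j"
proof -
  have "(A ** diag_matrix d) $ i $ j = (\<Sum>k\<in>UNIV. if k = j then A $ i $ j * d j else 0)"
    by (subst matrix_matrix_mult_def, simp only: vec_lambda_beta, intro sum.cong) auto
  then show ?thesis by simp
qed

lemma diag_matrix_mult [simp]: "diag_matrix c ** diag_matrix d = diag_matrix (\<lambda>i. c i * d i)"
  by (simp add: vec_eq_iff diag_matrix_mult_left_nth)

lemma diag_matrix_1: "diag_matrix (\<lambda>i. 1) = mat 1"
  by (simp add: diag_matrix_def mat_def)

lemma det_diag_matrix [simp]: "det (diag_matrix d) = prod d UNIV"
  by (subst det_diagonal) auto

lemma trace_diag_matrix [simp]: "trace (diag_matrix d) = sum d UNIV"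
  by (simp add: trace_def)

lemma conj_transpose_diag_matrix [simp]:
  "conj_transpose (diag_matrix d) = diag_matrix (\<lambda>i. cnj (d i))"
  by (auto simp: conj_transpose_def vec_eq_iff)

lemma conj_transpose_conj_transpose [simp]: "conj_transpose (conj_transpose A) = A"
  by (simp add: conj_transpose_def vec_eq_iff)

lemma conj_transpose_mult: "conj_transpose (A ** B) = conj_transpose B ** conj_transpose A"
  by (simp add: conj_transpose_def vec_eq_iff matrix_matrix_mult_def mult.commute)

lemma det_conj_transpose: "det (conj_transpose A) = cnj (det A)"
proof -
  have "det (conj_transpose A) = det (transpose (conj_transpose A))"
    by (simp add: det_transpose)
  also have "\<dots> = cnj (det A)"
    by (simp add: det_def transpose_def conj_transpose_def)
  finally show ?thesis .
qed

text \<open>A bijection from the index type to a full set of orthonormal eigenvectors makes them the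
  columns of \<open>U\<close>; orthonormality is unitarity, and \<open>A ** U\<close> scales the
  columns by the eigenvalues.\<close>

lemma hermitian_spectral:
  fixes A :: "complex^'n^'n"
  assumes A: "conj_transpose A = A"
  obtains U and d :: "'n \<Rightarrow> real" where "conj_transpose U ** U = mat 1" "U ** conj_transpose U = mat 1"
    "A = U ** diag_matrix (\<lambda>i. of_real (d i)) ** conj_transpose U"
proof -
  obtain S where S: "finite S" "card S = CARD('n)" "\<And>x. x \<in> S \<Longrightarrow> \<exists>l::real. A *v x = l *\<^sub>R x"
     "\<And>x y. x \<in> S \<Longrightarrow> y \<in> S \<Longrightarrow> cinner x y = (if x = y then 1 else 0)"
    using hermitian_orthonormal_eigenvectors[OF A order_refl] by blast
  obtain f where f: "bij_betw f (UNIV :: 'n set) S"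
    using S finite_same_card_bij[of "UNIV :: 'n set" S] by auto
  then have fS: "f i \<in> S" and inj: "f i = f j \<longleftrightarrow> i = j" for i j
    by (auto simp: bij_betw_def inj_def)
  have "\<forall>i. \<exists>l::real. A *v f i = l *\<^sub>R f i"
    using S(3) fS by blast
  then obtain d :: "'n \<Rightarrow> real" where d: "\<And>i. A *v f i = d i *\<^sub>R f i"
    using choice[of "\<lambda>i l. A *v f i = l *\<^sub>R f i"] by blast
  define U :: "complex^'n^'n" where "U = (\<chi> i j. f j $ i)"
  have 1: "conj_transpose U ** U = mat 1"
  proof -
    have "(conj_transpose U ** U) $ i $ j = cinner (f i) (f j)" for i j
      by (simp add: U_def conj_transpose_def matrix_matrix_mult_def cinner_def)
    then have "(conj_transpose U ** U) $ i $ j = mat 1 $ i $ j" for i j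
      by (simp add: mat_def S(4) fS inj)
    then show ?thesis
      by (simp add: vec_eq_iff)
  qed
  then have 2: "U ** conj_transpose U = mat 1"
    by (simp add: matrix_left_right_inverse)
  have "(A ** U) $ i $ j = (U ** diag_matrix (\<lambda>i. of_real (d i))) $ i $ j" for i j
  proof -
    have "(A ** U) $ i $ j = (A *v f j) $ i"
      by (simp add: U_def matrix_matrix_mult_def matrix_vector_mult_def)
    also have "\<dots> = f j $ i * of_real (d j)"
      by (simp only: d vector_scaleR_component, simp add: scaleR_conv_of_real)
    also have "\<dots> = (U ** diag_matrix (\<lambda>i. of_real (d i))) $ i $ j"
      by (simp add: U_def diag_matrix_mult_right_nth)
    finally show ?thesis .
  qed
  then have "A ** U = U ** diag_matrix (\<lambda>i. of_real (d i))"
    by (simp add: vec_eq_iff)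
  then have "A ** (U ** conj_transpose U) = U ** diag_matrix (\<lambda>i. of_real (d i)) ** conj_transpose U"
    by (simp add: matrix_mul_assoc)
  with 1 2 that show ?thesis
    by simp
qed

section \<open>Positive semidefinite matrices and the modulus\<close>

lemma cnj_mult_self: "cnj z * z = (of_real (cmod z))\<^sup>2"
  by (metis complex_norm_square mult.commute of_real_power)

lemma congruence_nth:
  "(conj_transpose P ** B ** P) $ i $ j = (\<Sum>a\<in>UNIV. \<Sum>b\<in>UNIV. cnj (P $ a $ i) * B $ a $ b * P $ b $ j)"
proof -
  have "(conj_transpose P ** B ** P) $ i $ j
      = (\<Sum>b\<in>UNIV. \<Sum>a\<in>UNIV. cnj (P $ a $ i) * B $ a $ b * P $ b $ j)"
    by (simp add: matrix_matrix_mult_def conj_transpose_def sum_distrib_right)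
  also have "\<dots> = (\<Sum>a\<in>UNIV. \<Sum>b\<in>UNIV. cnj (P $ a $ i) * B $ a $ b * P $ b $ j)"
    by (rule sum.swap)
  finally show ?thesis .
qed

text \<open>Lets the entries of a diagonalised matrix be recognised as values of the original form,
  so that sign and sector conditions pass to them.\<close>

lemma quad_form_column: "quad_form B (column i P) = (conj_transpose P ** B ** P) $ i $ i"
  by (simp add: congruence_nth quad_form_def column_def)

lemma quad_form_congruence: "quad_form (conj_transpose P ** B ** P) x = quad_form B (P *v x)"
  by (simp add: quad_form_cinner matrix_vector_mul_assoc[symmetric] cinner_matrix_vector[of x])

lemma cnj_quad_form: "cnj (quad_form A x) = quad_form (conj_transpose A) x"
  by (simp add: quad_form_cinner cnj_cinner cinner_matrix_vector[of x "conj_transpose A"])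

lemma hermitian_quad_form_real: "conj_transpose A = A \<Longrightarrow> Im (quad_form A x) = 0"
  using cnj_quad_form[of A x] by (metis Reals_cnj_iff complex_is_Real_iff)

lemma column_nonzero_if_left_inverse:
  fixes U :: "complex^'n^'n"
  assumes "V ** U = mat 1"
  shows "column i U \<noteq> 0"
proof
  assume "column i U = 0"
  then have "U $ k $ i = 0" for k
    by (simp add: column_def vec_eq_iff)
  then have "(V ** U) $ i $ i = 0"
    by (simp add: matrix_matrix_mult_def)
  then show False
    by (simp add: assms mat_def)
qed

lemma unitary_congruence:
  fixes U :: "complex^'n^'n"
  assumes "conj_transpose U ** U = mat 1"
  shows "conj_transpose U ** (U ** D ** conj_transpose U) ** U = D"
proof -
  have "conj_transpose U ** (U ** D ** conj_transpose U) ** U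
      = (conj_transpose U ** U) ** D ** (conj_transpose U ** U)"
    by (simp only: matrix_mul_assoc)
  then show ?thesis
    by (simp add: assms)
qed

lemma unitary_similarity_mult:
  fixes U :: "complex^'n^'n"
  assumes "conj_transpose U ** U = mat 1"
  shows "(U ** D ** conj_transpose U) ** (U ** E ** conj_transpose U) = U ** (D ** E) ** conj_transpose U"
proof -
  have "(U ** D ** conj_transpose U) ** (U ** E ** conj_transpose U)
      = U ** D ** (conj_transpose U ** U) ** E ** conj_transpose U"
    by (simp only: matrix_mul_assoc)
  then show ?thesis
    by (simp add: assms matrix_mul_assoc)
qed

lemma det_unitary_similarity:
  fixes U :: "complex^'n^'n"
  assumes "conj_transpose U ** U = mat 1"
  shows "det (U ** D ** conj_transpose U) = det D"
proof -
  have "det (conj_transpose U) * det U = 1"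
    using assms by (metis det_mul det_I)
  then show ?thesis
    by (simp add: det_mul mult_ac)
qed

lemma trace_unitary_similarity:
  fixes U :: "complex^'n^'n"
  assumes "conj_transpose U ** U = mat 1"
  shows "trace (U ** D ** conj_transpose U) = trace D"
  by (simp add: trace_mul_sym[of "U ** D"] matrix_mul_assoc assms)

section \<open>Eigenvalues, determinant and trace of positive matrices\<close>

definition pos_def :: "complex^'n^'n \<Rightarrow> bool" where
  "pos_def B \<longleftrightarrow> conj_transpose B = B \<and> (\<forall>x. x \<noteq> 0 \<longrightarrow> 0 < Re (quad_form B x))"

lemma quad_form_0 [simp]: "quad_form A 0 = 0"
  by (simp add: quad_form_def)

lemma pos_def_imp_psd: "pos_def B \<Longrightarrow> psd B"
  unfolding pos_def_def psd_def
  by (metis hermitian_quad_form_real less_imp_le order_refl quad_form_0 zero_complex.sel(1))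

lemma psd_spectral:
  assumes "psd A"
  obtains U d where "conj_transpose U ** U = mat 1" "U ** conj_transpose U = mat 1"
    "A = U ** diag_matrix (\<lambda>i. of_real (d i)) ** conj_transpose U" "\<And>i. 0 \<le> d i"
proof -
  obtain U d where U: "conj_transpose U ** U = mat 1" "U ** conj_transpose U = mat 1"
    "A = U ** diag_matrix (\<lambda>i. of_real (d i)) ** conj_transpose U"
    using hermitian_spectral assms psd_def by metis
  have "quad_form A (column i U) = of_real (d i)" for i
    using unitary_congruence[OF U(1), of "diag_matrix (\<lambda>i. of_real (d i))"]
    by (simp add: quad_form_column U(3))
  then have "0 \<le> d i" for i
    using assms by (metis psd_def Re_complex_of_real)
  with U that show ?thesis
    by blast
qed

lemma pos_def_spectral:
  assumes "pos_def A"
  obtains U d where "conj_transpose U ** U = mat 1" "U ** conj_transpose U = mat 1"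
    "A = U ** diag_matrix (\<lambda>i. of_real (d i)) ** conj_transpose U" "\<And>i. 0 < d i"
proof -
  obtain U d where U: "conj_transpose U ** U = mat 1" "U ** conj_transpose U = mat 1"
    "A = U ** diag_matrix (\<lambda>i. of_real (d i)) ** conj_transpose U"
    using hermitian_spectral assms pos_def_def by metis
  have "quad_form A (column i U) = of_real (d i)" for i
    using unitary_congruence[OF U(1), of "diag_matrix (\<lambda>i. of_real (d i))"]
    by (simp add: quad_form_column U(3))
  then have "0 < d i" for i
    using assms column_nonzero_if_left_inverse[OF U(1)] by (metis pos_def_def Re_complex_of_real)
  with U that show ?thesis
    by blast
qed

lemma psd_det:
  assumes "psd A"
  shows "Im (det A) = 0" "0 \<le> Re (det A)"
proof -
  obtain U d where U: "conj_transpose U ** U = mat 1" "U ** conj_transpose U = mat 1"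
    "A = U ** diag_matrix (\<lambda>i. of_real (d i)) ** conj_transpose U" "\<And>i. 0 \<le> d i"
    using psd_spectral[OF assms] by blast
  have "det A = of_real (\<Prod>i\<in>UNIV. d i)"
    by (simp add: U(3) det_unitary_similarity[OF U(1)])
  then show "Im (det A) = 0" "0 \<le> Re (det A)"
    using U(4) by (simp_all add: prod_nonneg del: of_real_prod)
qed

text \<open>The inequality of arithmetic and geometric means, raised to the n-th power and cleared
  of denominators so that it fits determinants and traces.\<close>

lemma prod_le_mean_power:
  fixes d :: "'n::finite \<Rightarrow> real"
  assumes "\<And>i. 0 \<le> d i"
  shows "real CARD('n) ^ CARD('n) * (\<Prod>i\<in>UNIV. d i) \<le> (\<Sum>i\<in>UNIV. d i) ^ CARD('n)"
proof -
  let ?n = "CARD('n)"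
  have P: "0 \<le> (\<Prod>i\<in>UNIV. d i)"
    by (simp add: assms prod_nonneg)
  \<comment> \<open>A zero product is treated apart because \<open>powr_realpow\<close> requires a
    positive base.\<close>
  have "(\<Prod>i\<in>UNIV. d i) = ((\<Prod>i\<in>UNIV. d i) powr (1 / ?n)) ^ ?n"
    using P by (cases "(\<Prod>i\<in>UNIV. d i) = 0") (simp_all add: powr_realpow[symmetric] powr_powr del: prod_zero_iff)
  also have "\<dots> \<le> (\<Sum>i\<in>UNIV. d i / ?n) ^ ?n"
    by (intro power_mono arith_geom_mean) (auto simp: assms)
  also have "\<dots> = (\<Sum>i\<in>UNIV. d i) ^ ?n / ?n ^ ?n"
    by (simp add: sum_divide_distrib[symmetric] power_divide)
  finally show ?thesis
    by (simp add: field_simps)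
qed

lemma psd_det_le_trace_power:
  fixes A :: "complex^'n^'n"
  assumes "psd A"
  shows "real CARD('n) ^ CARD('n) * Re (det A) \<le> Re (trace A) ^ CARD('n)" "0 \<le> Re (trace A)"
proof -
  obtain U d where U: "conj_transpose U ** U = mat 1" "U ** conj_transpose U = mat 1"
    "A = U ** diag_matrix (\<lambda>i. of_real (d i)) ** conj_transpose U" "\<And>i. 0 \<le> d i"
    using psd_spectral[OF assms] by blast
  have "det A = of_real (\<Prod>i\<in>UNIV. d i)" "trace A = of_real (\<Sum>i\<in>UNIV. d i)"
    by (simp_all add: U(3) det_unitary_similarity[OF U(1)] trace_unitary_similarity[OF U(1)])
  then show "real CARD('n) ^ CARD('n) * Re (det A) \<le> Re (trace A) ^ CARD('n)" "0 \<le> Re (trace A)"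
    using prod_le_mean_power[of d] U(4) by (simp_all add: sum_nonneg del: of_real_prod of_real_sum)
qed

text \<open>In the coordinates \<open>conj_transpose U *v x\<close> the form is a sum of squared
  moduli with the nonnegative weights \<open>d i\<close>.\<close>

lemma psd_unitary_diag:
  assumes "\<And>i. 0 \<le> d i"
  shows "psd (U ** diag_matrix (\<lambda>i. of_real (d i)) ** conj_transpose U)"
proof -
  let ?D = "diag_matrix (\<lambda>i. complex_of_real (d i))"
  have q: "quad_form ?D x = of_real (\<Sum>i\<in>UNIV. d i * (cmod (x $ i))\<^sup>2)" for x
  proof -
    have "?D *v x = (\<chi> i. of_real (d i) * x $ i)"
      unfolding matrix_vector_mult_def
      by (simp add: vec_eq_iff if_distrib if_distribR cong: if_cong)
    then show ?thesis
      by (simp add: quad_form_cinner cinner_def cnj_mult_self[symmetric]) (simp add: mult_ac)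
  qed
  have "quad_form (U ** ?D ** conj_transpose U) x
      = of_real (\<Sum>i\<in>UNIV. d i * (cmod ((conj_transpose U *v x) $ i))\<^sup>2)" for x
    using quad_form_congruence[of "conj_transpose U" ?D x] by (simp add: q)
  then show ?thesis
    unfolding psd_def
    by (auto simp: conj_transpose_mult matrix_mul_assoc assms sum_nonneg)
qed

lemma psd_conj_transpose_mult_self: "psd (conj_transpose A ** A)"
proof -
  have "quad_form (conj_transpose A ** A) x = of_real ((norm (A *v x))\<^sup>2)" for x
    by (simp add: quad_form_cinner matrix_vector_mul_assoc[symmetric]
        cinner_matrix_vector[of x] cinner_self)
  then show ?thesis
    by (simp add: psd_def conj_transpose_mult)
qed

text \<open>An eigenvector \<open>v\<close> of \<open>D = P - Q\<close> with eigenvalue \<open>d\<close> satisfies \<open>d (v\<^sup>*Pv + v\<^sup>*Qv) = 0\<close>, because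
  \<open>P D + D Q = 0\<close>; if \<open>d \<noteq> 0\<close>, both forms vanish at \<open>v\<close>, hence so does \<open>v\<^sup>*Dv = d\<close>.\<close>

lemma psd_square_inject:
  assumes P: "psd P" and Q: "psd Q" and eq: "P ** P = Q ** Q"
  shows "P = Q"
proof -
  define D where "D = P - Q"
  have "conj_transpose D = D"
    using P Q by (simp add: D_def psd_def conj_transpose_def vec_eq_iff)
  then obtain U d where U: "conj_transpose U ** U = mat 1" "U ** conj_transpose U = mat 1"
    "D = U ** diag_matrix (\<lambda>i. of_real (d i)) ** conj_transpose U"
    using hermitian_spectral by metis
  have "d i = 0" for i
  proof -
    define v where "v = column i U"
    have DU: "D ** U = U ** diag_matrix (\<lambda>i. of_real (d i))"
      by (simp add: U(3) matrix_mul_assoc[symmetric] U(1))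
    have Dv: "D *v v = of_real (d i) *s v"
    proof -
      have "(D *v v) $ k = (D ** U) $ k $ i" for k
        by (simp add: v_def column_def matrix_matrix_mult_def matrix_vector_mult_def)
      then show ?thesis
        by (simp add: DU diag_matrix_mult_right_nth vec_eq_iff v_def column_def)
    qed
    have vv: "cinner v v = 1"
    proof -
      have "cinner v v = (conj_transpose U ** U) $ i $ i"
        by (simp add: v_def column_def cinner_def matrix_matrix_mult_def conj_transpose_def)
      then show ?thesis
        by (simp add: U(1) mat_def)
    qed
    have "quad_form (P ** P) v = cinner v (P *v (Q *v v)) + of_real (d i) * quad_form P v"
    proof -
      have "P *v v = Q *v v + D *v v"
        by (simp add: D_def matrix_vector_mult_diff_rdistrib)
      then have "P *v (P *v v) = P *v (Q *v v) + of_real (d i) *s (P *v v)"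
        by (simp add: Dv matrix_vector_right_distrib vector_scalar_commute)
      then show ?thesis
        by (simp add: quad_form_cinner matrix_vector_mul_assoc[symmetric] cinner_add_right cinner_scale_right)
    qed
    moreover have "cinner v (P *v (Q *v v)) = quad_form (Q ** Q) v + of_real (d i) * quad_form Q v"
    proof -
      have "cinner v (P *v (Q *v v)) = cinner v (Q *v (Q *v v)) + cinner v (D *v (Q *v v))"
        by (simp add: D_def matrix_vector_mult_diff_rdistrib cinner_add_right[symmetric])
      also have "cinner v (D *v (Q *v v)) = cinner (D *v v) (Q *v v)"
        by (simp add: cinner_matrix_vector \<open>conj_transpose D = D\<close>)
      also have "\<dots> = of_real (d i) * cinner v (Q *v v)"
        by (simp add: Dv cinner_def sum_distrib_left mult_ac)
      finally show ?thesis
        by (simp add: quad_form_cinner matrix_vector_mul_assoc[symmetric])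
    qed
    ultimately have "of_real (d i) * (quad_form P v + quad_form Q v) = 0"
      by (simp add: eq algebra_simps)
    moreover have "of_real (d i) = quad_form P v - quad_form Q v"
    proof -
      have "of_real (d i) = cinner v (D *v v)"
        by (simp add: Dv cinner_scale_right vv)
      also have "\<dots> = quad_form P v - quad_form Q v"
        by (simp add: D_def quad_form_cinner[symmetric]) (simp add: quad_form_def sum_subtractf algebra_simps)
      finally show ?thesis .
    qed
    moreover have "Im (quad_form P v) = 0" "0 \<le> Re (quad_form P v)"
      "Im (quad_form Q v) = 0" "0 \<le> Re (quad_form Q v)"
      using P Q by (auto simp: psd_def)
    ultimately show ?thesis
      by (auto simp: complex_eq_iff)
  qed
  then have "D = 0"
    by (simp add: U(3)) (simp add: vec_eq_iff matrix_matrix_mult_def)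
  then show ?thesis
    by (simp add: D_def)
qed

text \<open>Square roots of the eigenvalues of \<open>conj_transpose A ** A\<close> give existence
  and \<open>psd_square_inject\<close> gives uniqueness, so the definite description in the
  definition denotes.\<close>

lemma matrix_modulus_psd: "psd (matrix_modulus A)"
  and matrix_modulus_square: "matrix_modulus A ** matrix_modulus A = conj_transpose A ** A"
proof -
  obtain U d where U: "conj_transpose U ** U = mat 1" "U ** conj_transpose U = mat 1"
    "conj_transpose A ** A = U ** diag_matrix (\<lambda>i. of_real (d i)) ** conj_transpose U" "\<And>i. 0 \<le> d i"
    using psd_spectral[OF psd_conj_transpose_mult_self] by blast
  define B where "B = U ** diag_matrix (\<lambda>i. of_real (sqrt (d i))) ** conj_transpose U"
  have "psd B"
    unfolding B_def by (rule psd_unitary_diag) (simp add: U(4))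
  moreover have "B ** B = conj_transpose A ** A"
    unfolding B_def unitary_similarity_mult[OF U(1)] U(3)
    by (simp add: U(4) of_real_mult[symmetric] del: of_real_mult)
  ultimately have "\<exists>!B. psd B \<and> B ** B = conj_transpose A ** A"
    using psd_square_inject by metis
  from theI'[OF this] show "psd (matrix_modulus A)"
    "matrix_modulus A ** matrix_modulus A = conj_transpose A ** A"
    unfolding matrix_modulus_def by auto
qed

text \<open>Both sides are nonnegative and their squares are the determinant of
  \<open>conj_transpose A ** A\<close>.\<close>

lemma det_matrix_modulus: "Re (det (matrix_modulus A)) = cmod (det A)"
proof -
  let ?B = "matrix_modulus A"
  have B: "det ?B = of_real (Re (det ?B))"
    using psd_det(1)[OF matrix_modulus_psd] by (simp add: complex_eq_iff)
  have "of_real ((Re (det ?B))\<^sup>2) = det ?B * det ?B"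
    by (subst (2 3) B) (simp add: power2_eq_square)
  also have "\<dots> = cnj (det A) * det A"
    by (metis matrix_modulus_square det_mul det_conj_transpose)
  also have "\<dots> = of_real ((cmod (det A))\<^sup>2)"
    by (simp add: cnj_mult_self)
  finally have "(Re (det ?B))\<^sup>2 = (cmod (det A))\<^sup>2"
    using of_real_eq_iff by blast
  then show ?thesis
    by (rule power2_eq_imp_eq) (simp_all add: psd_det(2) matrix_modulus_psd)
qed

text \<open>In an eigenbasis of the modulus, \<open>A\<close> becomes a matrix \<open>M\<close>
  whose i-th column has norm \<open>d i\<close>. Each diagonal entry is bounded by the norm of its
  column, and the trace is unchanged.\<close>

lemma Re_trace_le_trace_matrix_modulus: "Re (trace A) \<le> Re (trace (matrix_modulus A))"
proof -
  obtain U d where U: "conj_transpose U ** U = mat 1" "U ** conj_transpose U = mat 1"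
    "matrix_modulus A = U ** diag_matrix (\<lambda>i. of_real (d i)) ** conj_transpose U" "\<And>i. 0 \<le> d i"
    using psd_spectral[OF matrix_modulus_psd] by blast
  define M where "M = conj_transpose U ** A ** U"
  have "conj_transpose M ** M = conj_transpose U ** (conj_transpose A ** (U ** conj_transpose U) ** A) ** U"
    by (simp only: M_def conj_transpose_mult conj_transpose_conj_transpose matrix_mul_assoc)
  also have "\<dots> = conj_transpose U ** (matrix_modulus A ** matrix_modulus A) ** U"
    by (simp add: U(2) matrix_modulus_square)
  also have "\<dots> = diag_matrix (\<lambda>i. of_real ((d i)\<^sup>2))"
    unfolding U(3) unitary_similarity_mult[OF U(1)] unitary_congruence[OF U(1)]
    by (simp add: power2_eq_square)
  finally have MM: "conj_transpose M ** M = diag_matrix (\<lambda>i. of_real ((d i)\<^sup>2))" .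
  have le: "Re (M $ i $ i) \<le> d i" for i
  proof -
    have "of_real (\<Sum>k\<in>UNIV. (cmod (M $ k $ i))\<^sup>2) = (conj_transpose M ** M) $ i $ i"
      by (simp add: matrix_matrix_mult_def conj_transpose_def cnj_mult_self)
    also have "\<dots> = of_real ((d i)\<^sup>2)"
      by (simp add: MM)
    finally have "(\<Sum>k\<in>UNIV. (cmod (M $ k $ i))\<^sup>2) = (d i)\<^sup>2"
      using of_real_eq_iff by blast
    moreover have "(cmod (M $ i $ i))\<^sup>2 \<le> (\<Sum>k\<in>UNIV. (cmod (M $ k $ i))\<^sup>2)"
      by (intro member_le_sum) auto
    ultimately have "cmod (M $ i $ i) \<le> d i"
      using U(4) by (metis power2_le_imp_le)
    then show ?thesis
      using complex_Re_le_cmod order_trans by blast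
  qed
  have "trace A = trace M"
    by (simp add: M_def trace_mul_sym[of "conj_transpose U ** A"] matrix_mul_assoc U(2))
  then have "Re (trace A) \<le> (\<Sum>i\<in>UNIV. d i)"
    by (simp add: trace_def sum_mono le)
  also have "\<dots> = Re (trace (matrix_modulus A))"
    by (simp add: U(3) trace_unitary_similarity[OF U(1)])
  finally show ?thesis .
qed

section \<open>Sectorial matrices\<close>

definition herm_part :: "complex^'n^'n \<Rightarrow> complex^'n^'n" where
  "herm_part B = (\<chi> i j. (B $ i $ j + cnj (B $ j $ i)) / 2)"

text \<open>The matrix K in the Cartesian decomposition B = H + iK; dividing by
  \<open>2 * \<i>\<close> makes it Hermitian.\<close>

definition skew_part :: "complex^'n^'n \<Rightarrow> complex^'n^'n" where
  "skew_part B = (\<chi> i j. (B $ i $ j - cnj (B $ j $ i)) / (2 * \<i>))"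

lemma herm_part_hermitian: "conj_transpose (herm_part B) = herm_part B"
  by (simp add: herm_part_def conj_transpose_def vec_eq_iff add.commute)

lemma skew_part_hermitian: "conj_transpose (skew_part B) = skew_part B"
  by (simp add: skew_part_def conj_transpose_def vec_eq_iff field_simps)

lemma nth_herm_skew: "B $ i $ j = herm_part B $ i $ j + \<i> * skew_part B $ i $ j"
  by (simp add: herm_part_def skew_part_def field_simps)

lemma quad_form_herm_skew: "quad_form B x = quad_form (herm_part B) x + \<i> * quad_form (skew_part B) x"
  unfolding quad_form_def
  by (subst nth_herm_skew) (simp add: sum.distrib sum_distrib_left algebra_simps)

lemma Re_quad_form_herm_part: "Re (quad_form (herm_part B) x) = Re (quad_form B x)"
  using quad_form_herm_skew[of B x] hermitian_quad_form_real[OF skew_part_hermitian, of B x] by simp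

lemma trace_herm_part: "trace (herm_part B) = of_real (Re (trace B))"
  by (simp add: trace_def herm_part_def complex_eq_iff)

text \<open>The numerical range condition in homogeneous form, with \<open>t\<close> in the place of
  the tangent. Without normalised vectors it passes easily through congruences and partial
  traces.\<close>

definition sectorial :: "real \<Rightarrow> complex^'n^'n \<Rightarrow> bool" where
  "sectorial t B \<longleftrightarrow> (\<forall>x. x \<noteq> 0 \<longrightarrow>
     0 < Re (quad_form B x) \<and> \<bar>Im (quad_form B x)\<bar> \<le> Re (quad_form B x) * t)"

lemma sectorial_pos_def_herm_part: "sectorial t B \<Longrightarrow> pos_def (herm_part B)"
  by (simp add: sectorial_def pos_def_def herm_part_hermitian Re_quad_form_herm_part)

lemma sectorial_if_numerical_range:
  assumes "numerical_range A \<subseteq> sector \<alpha>"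
  shows "sectorial (tan \<alpha>) A"
  unfolding sectorial_def
proof (intro allI impI)
  fix x :: "complex^'a" assume "x \<noteq> 0"
  define y where "y = x /\<^sub>R norm x"
  have ny: "norm y = 1"
    using \<open>x \<noteq> 0\<close> by (simp add: y_def)
  have "(\<Sum>i\<in>UNIV. (cmod (y $ i))\<^sup>2) = (norm y)\<^sup>2"
    by (simp add: norm_vec_def L2_set_def sum_nonneg)
  with ny have "quad_form A y \<in> sector \<alpha>"
    using assms by (auto simp: numerical_range_def)
  then have y: "0 < Re (quad_form A y)" "\<bar>Im (quad_form A y)\<bar> \<le> Re (quad_form A y) * tan \<alpha>"
    by (auto simp: sector_def)
  have "x = norm x *\<^sub>R y"
    using \<open>x \<noteq> 0\<close> by (simp add: y_def)
  then have "x $ i = of_real (norm x) * y $ i" for i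
    by (metis vector_scaleR_component scaleR_conv_of_real)
  then have eq: "quad_form A x = of_real ((norm x)\<^sup>2) * quad_form A y"
    by (simp add: quad_form_def sum_distrib_left power2_eq_square mult_ac)
  have n: "0 < (norm x)\<^sup>2"
    using \<open>x \<noteq> 0\<close> by simp
  have Re: "Re (quad_form A x) = (norm x)\<^sup>2 * Re (quad_form A y)"
    and Im: "Im (quad_form A x) = (norm x)\<^sup>2 * Im (quad_form A y)"
    unfolding eq by (simp_all del: of_real_power)
  show "0 < Re (quad_form A x) \<and> \<bar>Im (quad_form A x)\<bar> \<le> Re (quad_form A x) * tan \<alpha>"
    unfolding Re Im abs_mult using n y
    by (simp add: mult.assoc)
qed

text \<open>A first congruence, built from the inverse square roots of the eigenvalues of
  \<open>H\<close>, carries \<open>H\<close> to the identity. A unitary \<open>V\<close> then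
  diagonalises the transformed \<open>K\<close> and leaves the identity fixed.\<close>

lemma simultaneous_diagonalization:
  assumes "pos_def H" and K: "conj_transpose K = K"
  obtains P and l :: "'n::finite \<Rightarrow> real" where "conj_transpose P ** H ** P = mat 1"
    "conj_transpose P ** K ** P = diag_matrix (\<lambda>i. of_real (l i))"
proof -
  obtain U d where U: "conj_transpose U ** U = mat 1" "U ** conj_transpose U = mat 1"
    "H = U ** diag_matrix (\<lambda>i. of_real (d i)) ** conj_transpose U" "\<And>i. 0 < d i"
    using pos_def_spectral[OF assms(1)] by blast
  define E where "E = diag_matrix (\<lambda>i. complex_of_real (1 / sqrt (d i)))"
  define P where "P = U ** E"
  have "1 / sqrt (d i) * d i * (1 / sqrt (d i)) = 1" for i
    using U(4)[of i] by (simp add: field_simps)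
  then have E: "E ** diag_matrix (\<lambda>i. of_real (d i)) ** E = mat 1"
    unfolding E_def diag_matrix_mult of_real_mult[symmetric] by (simp only: of_real_1 diag_matrix_1)
  have "conj_transpose P ** H ** P = E ** (conj_transpose U ** H ** U) ** E"
    by (simp add: P_def conj_transpose_mult matrix_mul_assoc) (simp add: E_def)
  also have "\<dots> = mat 1"
    unfolding U(3) unitary_congruence[OF U(1)] by (rule E)
  finally have PH: "conj_transpose P ** H ** P = mat 1" .
  have "conj_transpose (conj_transpose P ** K ** P) = conj_transpose P ** K ** P"
    by (simp add: conj_transpose_mult matrix_mul_assoc K)
  then obtain V l where V: "conj_transpose V ** V = mat 1" "V ** conj_transpose V = mat 1"
    "conj_transpose P ** K ** P = V ** diag_matrix (\<lambda>i. of_real (l i)) ** conj_transpose V"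
    using hermitian_spectral by metis
  have "conj_transpose (P ** V) ** X ** (P ** V) = conj_transpose V ** (conj_transpose P ** X ** P) ** V" for X
    by (simp add: conj_transpose_mult matrix_mul_assoc)
  then have "conj_transpose (P ** V) ** H ** (P ** V) = mat 1"
    "conj_transpose (P ** V) ** K ** (P ** V) = diag_matrix (\<lambda>i. of_real (l i))"
    by (simp_all add: PH V(3) unitary_congruence[OF V(1)] V(1))
  with that show ?thesis
    by blast
qed

text \<open>The congruence turns \<open>B\<close> into a diagonal matrix with entries
  \<open>1 + \<i> * l i\<close>, where \<open>\<bar>l i\<bar> \<le> t\<close> because these are form
  values at columns of \<open>P\<close>. Their moduli lie between 1 and
  \<open>sqrt (1 + t\<^sup>2)\<close>, and the common factor \<open>(cmod (det P))\<^sup>2\<close>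
  cancels.\<close>

lemma sectorial_det_bounds:
  fixes B :: "complex^'n^'n"
  assumes "sectorial t B"
  shows "Re (det (herm_part B)) \<le> cmod (det B)"
    and "cmod (det B) \<le> sqrt (1 + t\<^sup>2) ^ CARD('n) * Re (det (herm_part B))"
proof -
  obtain P and l :: "'n \<Rightarrow> real" where P: "conj_transpose P ** herm_part B ** P = mat 1"
    "conj_transpose P ** skew_part B ** P = diag_matrix (\<lambda>i. of_real (l i))"
    using simultaneous_diagonalization[OF sectorial_pos_def_herm_part[OF assms] skew_part_hermitian]
    by blast
  have "(conj_transpose P ** B ** P) $ i $ j
      = (conj_transpose P ** herm_part B ** P) $ i $ j + \<i> * (conj_transpose P ** skew_part B ** P) $ i $ j" for i j
    unfolding congruence_nth
    by (subst nth_herm_skew) (simp add: sum.distrib sum_distrib_left algebra_simps)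
  then have PB: "conj_transpose P ** B ** P = diag_matrix (\<lambda>i. 1 + \<i> * of_real (l i))"
    by (simp add: P vec_eq_iff mat_def)
  have l: "\<bar>l i\<bar> \<le> t" for i
  proof -
    have "quad_form B (column i P) = 1 + \<i> * of_real (l i)"
      by (simp add: quad_form_column PB)
    moreover have "column i P \<noteq> 0"
      using P(1) by (rule column_nonzero_if_left_inverse)
    ultimately show ?thesis
      using assms by (force simp: sectorial_def)
  qed
  define p where "p = (cmod (det P))\<^sup>2"
  have det: "det (conj_transpose P ** X ** P) = of_real p * det X" for X
    by (simp add: det_mul det_conj_transpose p_def cnj_mult_self[symmetric])
  have pH: "p * Re (det (herm_part B)) = 1"
    using det[of "herm_part B"] by (simp add: P complex_eq_iff)
  have p: "0 < p"
    using pH by (cases "det P = 0") (auto simp: p_def)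
  have "p * cmod (det B) = cmod (\<Prod>i\<in>UNIV. 1 + \<i> * of_real (l i))"
    using det[of B] p by (simp add: PB norm_mult)
  also have "\<dots> = (\<Prod>i\<in>UNIV. sqrt (1 + (l i)\<^sup>2))"
    by (simp only: prod_norm[symmetric]) (simp add: cmod_def)
  finally have pB: "p * cmod (det B) = (\<Prod>i\<in>UNIV. sqrt (1 + (l i)\<^sup>2))" .
  have "p * Re (det (herm_part B)) \<le> p * cmod (det B)"
    unfolding pH pB by (intro prod_ge_1) simp
  with p show "Re (det (herm_part B)) \<le> cmod (det B)"
    by simp
  have "(\<Prod>i\<in>UNIV. sqrt (1 + (l i)\<^sup>2)) \<le> (\<Prod>i\<in>(UNIV::'n set). sqrt (1 + t\<^sup>2))"
    using l by (intro prod_mono) (auto simp: abs_le_square_iff[symmetric] intro: order_trans[OF _ abs_ge_self])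
  then have "p * cmod (det B) \<le> sqrt (1 + t\<^sup>2) ^ CARD('n) * (p * Re (det (herm_part B)))"
    by (simp add: pB pH)
  with p show "cmod (det B) \<le> sqrt (1 + t\<^sup>2) ^ CARD('n) * Re (det (herm_part B))"
    by (simp add: mult.left_commute)
qed

text \<open>The upper determinant bound multiplied by a power of the cosine, using that
  \<open>sqrt (1 + (tan \<alpha>)\<^sup>2)\<close> is the secant.\<close>

lemma sectorial_det_le_cos:
  fixes B :: "complex^'n^'n"
  assumes "sectorial (tan \<alpha>) B" and "0 < cos \<alpha>"
  shows "cos \<alpha> ^ CARD('n) * cmod (det B) \<le> Re (det (herm_part B))"
proof -
  have "cos \<alpha> * sqrt (1 + (tan \<alpha>)\<^sup>2) = sqrt ((cos \<alpha>)\<^sup>2 * (1 + (tan \<alpha>)\<^sup>2))"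
    using assms(2) by (simp add: real_sqrt_mult)
  also have "(cos \<alpha>)\<^sup>2 * (1 + (tan \<alpha>)\<^sup>2) = 1"
    using assms(2) by (simp add: tan_sec field_simps)
  finally have 1: "cos \<alpha> ^ CARD('n) * sqrt (1 + (tan \<alpha>)\<^sup>2) ^ CARD('n) = 1"
    by (simp add: power_mult_distrib[symmetric])
  have "cos \<alpha> ^ CARD('n) * cmod (det B)
      \<le> cos \<alpha> ^ CARD('n) * (sqrt (1 + (tan \<alpha>)\<^sup>2) ^ CARD('n) * Re (det (herm_part B)))"
    using assms by (intro mult_left_mono sectorial_det_bounds) auto
  then show ?thesis
    by (simp only: mult.assoc[symmetric] 1 mult_1)
qed

section \<open>Partial traces\<close>

text \<open>The map \<open>\<phi>\<close> plays the role of \<open>X \<mapsto> I \<otimes> X\<close> or \<open>X \<mapsto> X \<otimes> I\<close>, and \<open>tr\<close> is its adjoint with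
  respect to the trace pairing, that is, the corresponding partial trace.\<close>

locale partial_trace =
  fixes \<phi> :: "complex^'q^'q \<Rightarrow> complex^'p^'p" and tr :: "complex^'p^'p \<Rightarrow> complex^'q^'q" and k :: nat
  assumes lift_mult: "\<phi> (X ** Y) = \<phi> X ** \<phi> Y"
    and lift_1: "\<phi> (mat 1) = mat 1"
    and lift_conj_transpose: "\<phi> (conj_transpose X) = conj_transpose (\<phi> X)"
    and det_lift_diag: "det (\<phi> (diag_matrix d)) = prod d UNIV ^ k"
    and card: "CARD('p) = k * CARD('q)"
    and trace_lift: "trace (A ** \<phi> X) = trace (tr A ** X)"
    and herm_part_tr: "herm_part (tr A) = tr (herm_part A)"
    and sectorial_tr: "sectorial t A \<Longrightarrow> sectorial t (tr A)"
begin

lemma trace_tr: "trace (tr A) = trace A"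
  using trace_lift[of A "mat 1"] by (simp add: lift_1)

text \<open>With \<open>G = (tr A)\<^sup>-\<^sup>1\<^sup>/\<^sup>2\<close> the matrix \<open>\<phi> G ** A ** \<phi> G\<close> has trace \<open>q\<close>, so the claim is the inequality
  between the arithmetic and geometric means of its eigenvalues.\<close>

lemma det_le_det_tr_power:
  assumes A: "psd A" and T: "pos_def (tr A)"
  shows "real k ^ CARD('p) * Re (det A) \<le> Re (det (tr A)) ^ k"
proof -
  obtain U d where U: "conj_transpose U ** U = mat 1" "U ** conj_transpose U = mat 1"
    "tr A = U ** diag_matrix (\<lambda>i. of_real (d i)) ** conj_transpose U" "\<And>i. 0 < d i"
    using pos_def_spectral[OF T] by blast
  define e where "e = (\<lambda>i. 1 / sqrt (d i))"
  define D where "D = diag_matrix (\<lambda>i. complex_of_real (e i))"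
  define G where "G = U ** D ** conj_transpose U"
  have e: "d i * (e i * e i) = 1" for i
    using U(4)[of i] by (simp add: e_def)
  have G: "conj_transpose G = G"
    by (simp add: G_def D_def conj_transpose_mult matrix_mul_assoc)
  have "tr A ** (G ** G) = U ** diag_matrix (\<lambda>i. of_real (d i * (e i * e i))) ** conj_transpose U"
    unfolding U(3) G_def D_def unitary_similarity_mult[OF U(1)] by simp
  then have TGG: "tr A ** (G ** G) = mat 1"
    by (simp add: e U(2) diag_matrix_1 del: of_real_mult)
  \<comment> \<open>The unitary factors of \<open>\<phi> G\<close> contribute 1 to its determinant,
    which leaves the diagonal factor covered by \<open>det_lift_diag\<close>.\<close>
  have "det (\<phi> U) * det (\<phi> (conj_transpose U)) = 1"
    by (simp only: det_mul[symmetric] lift_mult[symmetric] U(2) lift_1 det_I)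
  moreover have "det (\<phi> G) = det (\<phi> D) * (det (\<phi> U) * det (\<phi> (conj_transpose U)))"
    by (simp add: G_def lift_mult det_mul mult_ac)
  ultimately have detG: "det (\<phi> G) = of_real ((\<Prod>i\<in>UNIV. e i) ^ k)"
    by (simp add: D_def det_lift_diag)
  have detT: "Re (det (tr A)) = (\<Prod>i\<in>UNIV. d i)"
    unfolding U(3) det_unitary_similarity[OF U(1)] det_diag_matrix of_real_prod[symmetric] Re_complex_of_real ..
  define M where "M = conj_transpose (\<phi> G) ** A ** \<phi> G"
  have "psd M"
    using A by (simp add: psd_def M_def quad_form_congruence conj_transpose_mult matrix_mul_assoc)
  \<comment> \<open>Cyclicity of the trace gathers both factors \<open>\<phi> G\<close> on the
    right; the adjoint relation then moves them next to \<open>tr A\<close>, whose inverse is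
    \<open>G ** G\<close>.\<close>
  have "trace M = trace (A ** \<phi> (G ** G))"
    by (simp add: M_def lift_conj_transpose[symmetric] G lift_mult
        trace_mul_sym[of "\<phi> G"] matrix_mul_assoc[symmetric])
  also have "\<dots> = of_nat CARD('q)"
    by (simp add: trace_lift TGG trace_I)
  finally have trM: "Re (trace M) = real CARD('q)"
    by simp
  have "det M = of_real (((\<Prod>i\<in>UNIV. e i) ^ k)\<^sup>2) * det A"
    unfolding M_def det_mul lift_conj_transpose[symmetric] G detG by (simp add: power2_eq_square)
  then have detM: "Re (det M) = ((\<Prod>i\<in>UNIV. e i) ^ k)\<^sup>2 * Re (det A)"
    by (simp del: of_real_power)
  \<comment> \<open>Since \<open>e i * e i\<close> inverts \<open>d i\<close>, the determinant
    factor introduced by the normalisation is undone by \<open>det (tr A) ^ k\<close>.\<close>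
  have "Re (det (tr A)) ^ k * ((\<Prod>i\<in>UNIV. e i) ^ k)\<^sup>2 = (\<Prod>i\<in>UNIV. d i * (e i * e i)) ^ k"
    unfolding detT by (simp only: prod.distrib power_mult_distrib power2_eq_square)
  then have "Re (det (tr A)) ^ k * ((\<Prod>i\<in>UNIV. e i) ^ k)\<^sup>2 = 1"
    by (simp add: e)
  then have detA: "Re (det A) = Re (det (tr A)) ^ k * Re (det M)"
    by (simp only: detM mult.assoc[symmetric] mult_1)
  \<comment> \<open>With p = kq, the means inequality for \<open>M\<close> reads p^p det M \<le>
    q^p; cancelling q^p leaves k^p det M \<le> 1.\<close>
  have "real k ^ CARD('p) * (real CARD('q) ^ CARD('p) * Re (det M)) = real CARD('p) ^ CARD('p) * Re (det M)"
    by (simp only: card of_nat_mult power_mult_distrib mult.assoc)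
  also have "\<dots> \<le> real CARD('q) ^ CARD('p)"
    using psd_det_le_trace_power(1)[OF \<open>psd M\<close>] by (simp only: trM)
  finally have "real CARD('q) ^ CARD('p) * (real k ^ CARD('p) * Re (det M)) \<le> real CARD('q) ^ CARD('p) * 1"
    by (simp only: mult.left_commute mult_1_right)
  then have "real k ^ CARD('p) * Re (det M) \<le> 1"
    by (rule mult_left_le_imp_le) simp
  moreover have "0 \<le> Re (det (tr A)) ^ k"
    using psd_det(2)[OF pos_def_imp_psd[OF T]] by simp
  ultimately have "Re (det (tr A)) ^ k * (real k ^ CARD('p) * Re (det M)) \<le> Re (det (tr A)) ^ k * 1"
    by (rule mult_left_mono)
  then show ?thesis
    by (simp only: detA mult.left_commute mult_1_right)
qed

text \<open>The passage from \<open>A\<close> to its Hermitian part costs the power of the cosine;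
  the return from \<open>herm_part (tr A)\<close> to \<open>tr A\<close> is free, by the lower
  determinant bound.\<close>

lemma sectorial_det_le_det_tr:
  assumes A: "sectorial (tan \<alpha>) A" and c: "0 < cos \<alpha>"
  shows "(real k * cos \<alpha>) ^ CARD('p) * cmod (det A) \<le> cmod (det (tr A)) ^ k"
proof -
  note H = sectorial_pos_def_herm_part[OF A]
  note T = sectorial_pos_def_herm_part[OF sectorial_tr[OF A]]
  have "(real k * cos \<alpha>) ^ CARD('p) * cmod (det A)
      = real k ^ CARD('p) * (cos \<alpha> ^ CARD('p) * cmod (det A))"
    by (simp add: power_mult_distrib)
  also have "\<dots> \<le> real k ^ CARD('p) * Re (det (herm_part A))"
    by (intro mult_left_mono sectorial_det_le_cos A c) auto
  also have "\<dots> \<le> Re (det (tr (herm_part A))) ^ k"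
    using det_le_det_tr_power[OF pos_def_imp_psd[OF H]] T by (simp add: herm_part_tr)
  also have "\<dots> \<le> cmod (det (tr A)) ^ k"
    using sectorial_det_bounds(1)[OF sectorial_tr[OF A]] psd_det(2)[OF pos_def_imp_psd[OF T]]
    by (intro power_mono) (auto simp: herm_part_tr)
  finally show ?thesis .
qed

text \<open>Here the cosine is paid at \<open>tr A\<close>, a matrix of size q, and the means
  inequality compares determinant and trace of its Hermitian part, whose trace is the real part of
  \<open>trace A\<close>.\<close>

lemma sectorial_det_tr_le_trace_modulus:
  assumes A: "sectorial (tan \<alpha>) A" and c: "0 < cos \<alpha>"
  shows "(real CARD('q) * cos \<alpha>) ^ CARD('p) * cmod (det (tr A)) ^ k
    \<le> Re (trace (matrix_modulus A)) ^ CARD('p)"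
proof -
  let ?q = "CARD('q)"
  note T = pos_def_imp_psd[OF sectorial_pos_def_herm_part[OF sectorial_tr[OF A]]]
  have "(real ?q * cos \<alpha>) ^ ?q * cmod (det (tr A)) = real ?q ^ ?q * (cos \<alpha> ^ ?q * cmod (det (tr A)))"
    by (simp add: power_mult_distrib)
  also have "\<dots> \<le> real ?q ^ ?q * Re (det (herm_part (tr A)))"
    by (intro mult_left_mono sectorial_det_le_cos sectorial_tr A c) auto
  also have "\<dots> \<le> Re (trace (herm_part (tr A))) ^ ?q"
    by (rule psd_det_le_trace_power[OF T])
  also have "\<dots> \<le> Re (trace (matrix_modulus A)) ^ ?q"
    using psd_det_le_trace_power(2)[OF T] Re_trace_le_trace_matrix_modulus[of A]
    by (intro power_mono) (auto simp: trace_herm_part trace_tr)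
  \<comment> \<open>The k-th power turns the exponent q into kq = p.\<close>
  finally have "((real ?q * cos \<alpha>) ^ ?q * cmod (det (tr A))) ^ k \<le> (Re (trace (matrix_modulus A)) ^ ?q) ^ k"
    using c by (intro power_mono) auto
  then show ?thesis
    by (simp add: card power_mult_distrib power_mult[symmetric] mult.commute)
qed

end

section \<open>The partial traces over either factor of the index product\<close>

lemma sum_UNIV_prod: "(\<Sum>p\<in>UNIV. f p) = (\<Sum>i\<in>UNIV. \<Sum>k\<in>UNIV. f (i, k))"
  by (simp add: sum.cartesian_product)

lemma prod_UNIV_prod: "(\<Prod>p\<in>UNIV. f p) = (\<Prod>i\<in>UNIV. \<Prod>k\<in>UNIV. f (i, k))"
  by (simp add: prod.cartesian_product)

text \<open>The sector is a convex cone, so a nonempty finite sum of form values of \<open>A\<close>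
  at nonzero vectors stays in it.\<close>

lemma sectorial_sumI:
  assumes "sectorial t A" and "\<And>x. quad_form B x = (\<Sum>i\<in>(UNIV :: 'i::finite set). quad_form A (g i x))"
    and "\<And>i x. x \<noteq> 0 \<Longrightarrow> g i x \<noteq> 0"
  shows "sectorial t B"
  unfolding sectorial_def
proof (intro allI impI conjI)
  fix x assume "x \<noteq> (0 :: complex^'b)"
  then have g: "0 < Re (quad_form A (g i x))" "\<bar>Im (quad_form A (g i x))\<bar> \<le> Re (quad_form A (g i x)) * t" for i
    using assms(1,3) by (auto simp: sectorial_def)
  show "0 < Re (quad_form B x)"
    unfolding assms(2) Re_sum by (intro sum_pos) (auto simp: g)
  have "\<bar>Im (quad_form B x)\<bar> \<le> (\<Sum>i\<in>UNIV. \<bar>Im (quad_form A (g i x))\<bar>)"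
    unfolding assms(2) Im_sum by (rule sum_abs)
  also have "\<dots> \<le> (\<Sum>i\<in>UNIV. Re (quad_form A (g i x)) * t)"
    by (intro sum_mono g)
  finally show "\<bar>Im (quad_form B x)\<bar> \<le> Re (quad_form B x) * t"
    by (simp add: assms(2) sum_distrib_right)
qed

text \<open>The Kronecker product of the m by m identity with \<open>X\<close>.\<close>

definition lift1 :: "complex^'n^'n \<Rightarrow> complex^('m::finite \<times> 'n::finite)^('m \<times> 'n)" where
  "lift1 X = (\<chi> p q. if fst p = fst q then X $ snd p $ snd q else 0)"

text \<open>The Kronecker product of \<open>X\<close> with the n by n identity.\<close>

definition lift2 :: "complex^'m^'m \<Rightarrow> complex^('m::finite \<times> 'n::finite)^('m \<times> 'n)" where
  "lift2 X = (\<chi> p q. if snd p = snd q then X $ fst p $ fst q else 0)"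

text \<open>The vectors on the right are the tensors of the i-th unit vector with \<open>x\<close>,
  so each summand is the form of the i-th diagonal block.\<close>

lemma quad_form_ptrace1:
  "quad_form (ptrace1 A) x = (\<Sum>i\<in>UNIV. quad_form A (\<chi> p. if fst p = i then x $ snd p else 0))"
proof -
  have "quad_form A (\<chi> p. if fst p = i then x $ snd p else 0)
      = (\<Sum>k\<in>UNIV. \<Sum>l\<in>UNIV. cnj (x $ k) * A $ (i, k) $ (i, l) * x $ l)" for i
  proof -
    \<comment> \<open>Product indices are split into coordinates and the support condition is pulled
      out of the inner sums, so that the sums over the first coordinates collapse to
      \<open>i\<close>.\<close>
    have "quad_form A (\<chi> p. if fst p = i then x $ snd p else 0)
        = (\<Sum>j\<in>UNIV. if j = i then \<Sum>k\<in>UNIV. \<Sum>j'\<in>UNIV. if j' = i then \<Sum>l\<in>UNIV. cnj (x $ k) * A $ (i, k) $ (i, l) * x $ l else 0 else 0)"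
      unfolding quad_form_def sum_UNIV_prod
      by (intro sum.cong refl) (auto simp del: sum.delta sum.delta' intro!: sum.cong)
    then show ?thesis
      by simp
  qed
  then have "(\<Sum>i\<in>UNIV. quad_form A (\<chi> p. if fst p = i then x $ snd p else 0))
      = (\<Sum>i\<in>UNIV. \<Sum>k\<in>UNIV. \<Sum>l\<in>UNIV. cnj (x $ k) * A $ (i, k) $ (i, l) * x $ l)"
    by simp
  also have "\<dots> = (\<Sum>k\<in>UNIV. \<Sum>i\<in>UNIV. \<Sum>l\<in>UNIV. cnj (x $ k) * A $ (i, k) $ (i, l) * x $ l)"
    by (rule sum.swap)
  also have "\<dots> = (\<Sum>k\<in>UNIV. \<Sum>l\<in>UNIV. \<Sum>i\<in>UNIV. cnj (x $ k) * A $ (i, k) $ (i, l) * x $ l)"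
    by (intro sum.cong refl sum.swap)
  also have "\<dots> = quad_form (ptrace1 A) x"
    by (simp add: quad_form_def ptrace1_def sum_distrib_left sum_distrib_right)
  finally show ?thesis ..
qed

text \<open>The tensors of \<open>x\<close> with the k-th unit vector pick out the entries at
  position (k, k) of every block.\<close>

lemma quad_form_ptrace2:
  "quad_form (ptrace2 A) x = (\<Sum>k\<in>UNIV. quad_form A (\<chi> p. if snd p = k then x $ fst p else 0))"
proof -
  have "quad_form A (\<chi> p. if snd p = k then x $ fst p else 0)
      = (\<Sum>i\<in>UNIV. \<Sum>j\<in>UNIV. cnj (x $ i) * A $ (i, k) $ (j, k) * x $ j)" for k
  proof -
    have "quad_form A (\<chi> p. if snd p = k then x $ fst p else 0)
        = (\<Sum>i\<in>UNIV. \<Sum>k'\<in>UNIV. if k' = k then \<Sum>j\<in>UNIV. \<Sum>l\<in>UNIV. if l = k then cnj (x $ i) * A $ (i, k) $ (j, k) * x $ j else 0 else 0)"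
      unfolding quad_form_def sum_UNIV_prod
      by (intro sum.cong refl) (auto simp del: sum.delta sum.delta' intro!: sum.cong)
    then show ?thesis
      by simp
  qed
  then have "(\<Sum>k\<in>UNIV. quad_form A (\<chi> p. if snd p = k then x $ fst p else 0))
      = (\<Sum>k\<in>UNIV. \<Sum>i\<in>UNIV. \<Sum>j\<in>UNIV. cnj (x $ i) * A $ (i, k) $ (j, k) * x $ j)"
    by simp
  also have "\<dots> = (\<Sum>i\<in>UNIV. \<Sum>k\<in>UNIV. \<Sum>j\<in>UNIV. cnj (x $ i) * A $ (i, k) $ (j, k) * x $ j)"
    by (rule sum.swap)
  also have "\<dots> = (\<Sum>i\<in>UNIV. \<Sum>j\<in>UNIV. \<Sum>k\<in>UNIV. cnj (x $ i) * A $ (i, k) $ (j, k) * x $ j)"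
    by (intro sum.cong refl sum.swap)
  also have "\<dots> = quad_form (ptrace2 A) x"
    by (simp add: quad_form_def ptrace2_def sum_distrib_left sum_distrib_right)
  finally show ?thesis ..
qed

text \<open>The multiplicity is m because each diagonal entry of \<open>X\<close> occurs once in
  each of the m diagonal blocks of the lift.\<close>

interpretation ptrace1: partial_trace
  "lift1 :: complex^'n^'n \<Rightarrow> complex^('m::finite \<times> 'n::finite)^('m \<times> 'n)" ptrace1 "CARD('m)"
proof
  fix X Y :: "complex^'n^'n" and A :: "complex^('m \<times> 'n)^('m \<times> 'n)" and d :: "'n \<Rightarrow> complex" and t :: real
  show "lift1 (X ** Y) = (lift1 X ** lift1 Y :: complex^('m \<times> 'n)^('m \<times> 'n))"
  proof -
    have "(lift1 X ** lift1 Y :: complex^('m \<times> 'n)^('m \<times> 'n)) $ p $ q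
        = (\<Sum>j\<in>UNIV. if j = fst p then if fst p = fst q then \<Sum>l\<in>UNIV. X $ snd p $ l * Y $ l $ snd q else 0 else 0)" for p q
      unfolding matrix_matrix_mult_def sum_UNIV_prod lift1_def vec_lambda_beta
      by (intro sum.cong refl) auto
    then show ?thesis
      by (simp add: vec_eq_iff lift1_def matrix_matrix_mult_def)
  qed
  show "lift1 (mat 1) = (mat 1 :: complex^('m \<times> 'n)^('m \<times> 'n))"
    by (auto simp: lift1_def mat_def vec_eq_iff)
  show "lift1 (conj_transpose X) = (conj_transpose (lift1 X) :: complex^('m \<times> 'n)^('m \<times> 'n))"
    by (auto simp: lift1_def conj_transpose_def vec_eq_iff)
  have "lift1 (diag_matrix d) = (diag_matrix (\<lambda>p. d (snd p)) :: complex^('m \<times> 'n)^('m \<times> 'n))"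
    by (auto simp: lift1_def vec_eq_iff)
  then show "det (lift1 (diag_matrix d) :: complex^('m \<times> 'n)^('m \<times> 'n)) = prod d UNIV ^ CARD('m)"
    by (simp add: prod_UNIV_prod)
  show "CARD('m \<times> 'n) = CARD('m) * CARD('n)"
    by simp
  show "trace (A ** lift1 X) = trace (ptrace1 A ** X)"
  proof -
    have "(A ** lift1 X) $ (i, k) $ (i, k)
        = (\<Sum>j\<in>UNIV. if j = i then \<Sum>l\<in>UNIV. A $ (i, k) $ (i, l) * X $ l $ k else 0)" for i k
      unfolding matrix_matrix_mult_def sum_UNIV_prod lift1_def vec_lambda_beta
      by (intro sum.cong refl) auto
    then have "trace (A ** lift1 X) = (\<Sum>i\<in>UNIV. \<Sum>k\<in>UNIV. \<Sum>l\<in>UNIV. A $ (i, k) $ (i, l) * X $ l $ k)"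
      by (simp add: trace_def sum_UNIV_prod)
    also have "\<dots> = (\<Sum>k\<in>UNIV. \<Sum>i\<in>UNIV. \<Sum>l\<in>UNIV. A $ (i, k) $ (i, l) * X $ l $ k)"
      by (rule sum.swap)
    also have "\<dots> = (\<Sum>k\<in>UNIV. \<Sum>l\<in>UNIV. \<Sum>i\<in>UNIV. A $ (i, k) $ (i, l) * X $ l $ k)"
      by (intro sum.cong refl sum.swap)
    also have "\<dots> = trace (ptrace1 A ** X)"
      by (simp add: trace_def matrix_matrix_mult_def ptrace1_def sum_distrib_right)
    finally show ?thesis .
  qed
  show "herm_part (ptrace1 A) = ptrace1 (herm_part A)"
    by (simp add: herm_part_def ptrace1_def vec_eq_iff sum.distrib sum_divide_distrib[symmetric])
  show "sectorial t A \<Longrightarrow> sectorial t (ptrace1 A)"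
    by (erule sectorial_sumI[OF _ quad_form_ptrace1]) (auto simp: vec_eq_iff)
qed

interpretation ptrace2: partial_trace
  "lift2 :: complex^'m^'m \<Rightarrow> complex^('m::finite \<times> 'n::finite)^('m \<times> 'n)" ptrace2 "CARD('n)"
proof
  fix X Y :: "complex^'m^'m" and A :: "complex^('m \<times> 'n)^('m \<times> 'n)" and d :: "'m \<Rightarrow> complex" and t :: real
  show "lift2 (X ** Y) = (lift2 X ** lift2 Y :: complex^('m \<times> 'n)^('m \<times> 'n))"
  proof -
    have "(lift2 X ** lift2 Y :: complex^('m \<times> 'n)^('m \<times> 'n)) $ p $ q
        = (\<Sum>j\<in>UNIV. \<Sum>l\<in>UNIV. if l = snd p then if snd p = snd q then X $ fst p $ j * Y $ j $ fst q else 0 else 0)" for p q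
      unfolding matrix_matrix_mult_def sum_UNIV_prod lift2_def vec_lambda_beta
      by (intro sum.cong refl) auto
    then show ?thesis
      by (simp add: vec_eq_iff lift2_def matrix_matrix_mult_def)
  qed
  show "lift2 (mat 1) = (mat 1 :: complex^('m \<times> 'n)^('m \<times> 'n))"
    by (auto simp: lift2_def mat_def vec_eq_iff)
  show "lift2 (conj_transpose X) = (conj_transpose (lift2 X) :: complex^('m \<times> 'n)^('m \<times> 'n))"
    by (auto simp: lift2_def conj_transpose_def vec_eq_iff)
  have "lift2 (diag_matrix d) = (diag_matrix (\<lambda>p. d (fst p)) :: complex^('m \<times> 'n)^('m \<times> 'n))"
    by (auto simp: lift2_def vec_eq_iff)
  then show "det (lift2 (diag_matrix d) :: complex^('m \<times> 'n)^('m \<times> 'n)) = prod d UNIV ^ CARD('n)"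
    by (simp add: prod_UNIV_prod prod_power_distrib)
  show "CARD('m \<times> 'n) = CARD('n) * CARD('m)"
    by simp
  show "trace (A ** lift2 X) = trace (ptrace2 A ** X)"
  proof -
    have "(A ** lift2 X) $ (i, k) $ (i, k)
        = (\<Sum>j\<in>UNIV. \<Sum>l\<in>UNIV. if l = k then A $ (i, k) $ (j, k) * X $ j $ i else 0)" for i k
      unfolding matrix_matrix_mult_def sum_UNIV_prod lift2_def vec_lambda_beta
      by (intro sum.cong refl) auto
    then have "trace (A ** lift2 X) = (\<Sum>i\<in>UNIV. \<Sum>k\<in>UNIV. \<Sum>j\<in>UNIV. A $ (i, k) $ (j, k) * X $ j $ i)"
      by (simp add: trace_def sum_UNIV_prod)
    also have "\<dots> = (\<Sum>i\<in>UNIV. \<Sum>j\<in>UNIV. \<Sum>k\<in>UNIV. A $ (i, k) $ (j, k) * X $ j $ i)"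
      by (intro sum.cong refl sum.swap)
    also have "\<dots> = trace (ptrace2 A ** X)"
      by (simp add: trace_def matrix_matrix_mult_def ptrace2_def sum_distrib_right)
    finally show ?thesis .
  qed
  show "herm_part (ptrace2 A) = ptrace2 (herm_part A)"
    by (simp add: herm_part_def ptrace2_def vec_eq_iff sum.distrib sum_divide_distrib[symmetric])
  show "sectorial t A \<Longrightarrow> sectorial t (ptrace2 A)"
    by (erule sectorial_sumI[OF _ quad_form_ptrace2]) (auto simp: vec_eq_iff)
qed

theorem theorem4p8:
  fixes A :: "complex^('m::finite \<times> 'n::finite)^('m \<times> 'n)" and \<alpha> :: real
  assumes "0 \<le> \<alpha>" and "\<alpha> < pi / 2"
    and "numerical_range A \<subseteq> sector \<alpha>"
  shows "(Re (trace (matrix_modulus A))) ^ (CARD('m) * CARD('n))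
           + (cmod (det (ptrace1 A))) ^ CARD('m)
         \<ge> (real CARD('m) * cos \<alpha>) ^ (CARD('m) * CARD('n))
           * (Re (det (matrix_modulus A)) + (cmod (det (ptrace2 A))) ^ CARD('n))
         \<and> (Re (trace (matrix_modulus A))) ^ (CARD('m) * CARD('n))
           + (cmod (det (ptrace2 A))) ^ CARD('n)
         \<ge> (real CARD('n) * cos \<alpha>) ^ (CARD('m) * CARD('n))
           * (Re (det (matrix_modulus A)) + (cmod (det (ptrace1 A))) ^ CARD('m))"
proof -
  have A: "sectorial (tan \<alpha>) A"
    using assms(3) by (rule sectorial_if_numerical_range)
  have c: "0 < cos \<alpha>"
    using assms(1,2) by (intro cos_gt_zero_pi) auto
  \<comment> \<open>Each inequality is a sum of two estimates with a common factor: for m, the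
    determinant bound of \<open>ptrace1\<close> (multiplicity m) and the trace bound of
    \<open>ptrace2\<close> (size m); for n, the other two.\<close>
  show ?thesis
    using ptrace1.sectorial_det_le_det_tr[OF A c] ptrace2.sectorial_det_le_det_tr[OF A c]
      ptrace1.sectorial_det_tr_le_trace_modulus[OF A c] ptrace2.sectorial_det_tr_le_trace_modulus[OF A c]
    by (simp add: det_matrix_modulus distrib_left)
qed

end
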